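(* For arbitrary non-empty subsets $A,B\subset \mathbb{R}$, each regarded as a metric space with the metric induced from $\mathbb{R}$, we have $$d_{GH}(A, B)\le \max\bigl\{d_{GH}(A, \mathbb{R}),\, d_{GH}(B, \mathbb{R})\bigr\}.$$
   Context: $\mathbb{R}$ carries its standard metric $|x-y|$. The Gromov–Hausdorff distance $d_{GH}(X,Y)\in[0,\infty]$ between non-empty metric spaces $X$ and $Y$ is the infimum of the numbers $r\ge 0$ for which there exist a metric space $Z$ and subsets $X',Y'\subset Z$ isometric to $X$ and $Y$ respectively with $d_H(X',Y')\le r$, where $d_H$ is the Hausdorff distance in $Z$ (it equals $+\infty$ if there is no such $r$). Equivalently, $2d_{GH}(X,Y)=\inf\{\operatorname{dis} R\}$ over all correspondences $R\subset X\times Y$ (relations projecting surjectively onto both $X$ and $Y$), where $\operatorname{dis}R=\sup\{\,\bigl||xx'|-|yy'|\bigr| : (x,y),(x',y')\in R\}$. *)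

theory Defs
  imports "HOL-Analysis.Analysis"
begin

definition isometric_metric :: "'a metric \<Rightarrow> 'b metric \<Rightarrow> bool" where
  "isometric_metric X Y \<longleftrightarrow>
     (\<exists>f. f ` mspace X = mspace Y \<and>
          (\<forall>x\<in>mspace X. \<forall>x'\<in>mspace X. mdist Y (f x) (f x') = mdist X x x'))"

(* Valued in [0,\<infinity>], since the subsets need not be bounded. *)
definition hausdorff_dist :: "'a metric \<Rightarrow> 'a set \<Rightarrow> 'a set \<Rightarrow> ennreal" where
  "hausdorff_dist Z S T =
     max (SUP s\<in>S. INF t\<in>T. ennreal (mdist Z s t))
         (SUP t\<in>T. INF s\<in>S. ennreal (mdist Z s t))"

(* One cannot quantify over the type of the points of Z inside a definition.  Points of Z
   outside X' \<union> Y' are irrelevant, and X' \<union> Y' injects into the sum type 'a + 'b, so it is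
   enough to let Z range over the metric spaces carried by subsets of 'a + 'b;
   gh_dist_le below shows that a Z over any other type gives nothing new.
   The infimum of the empty set is \<infinity>. *)
definition gh_dist :: "'a metric \<Rightarrow> 'b metric \<Rightarrow> ennreal" where
  "gh_dist X Y =
     Inf {ennreal r | r. 0 \<le> r \<and>
       (\<exists>(Z :: ('a + 'b) metric) X' Y'. X' \<subseteq> mspace Z \<and> Y' \<subseteq> mspace Z \<and>
          isometric_metric (submetric Z X') X \<and> isometric_metric (submetric Z Y') Y \<and>
          hausdorff_dist Z X' Y' \<le> ennreal r)}"

lemma isometric_metric_image:
  fixes Z :: "'c metric" and W :: "'d metric"
  assumes iso: "isometric_metric (submetric Z S) X" and S: "S \<subseteq> mspace Z"
    and inj: "inj_on g S" and W: "g ` S \<subseteq> mspace W"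
    and d: "\<And>x y. x \<in> S \<Longrightarrow> y \<in> S \<Longrightarrow> mdist W (g x) (g y) = mdist Z x y"
  shows "isometric_metric (submetric W (g ` S)) X"
proof -
  obtain f where f: "f ` S = mspace X"
    "\<And>x x'. x \<in> S \<Longrightarrow> x' \<in> S \<Longrightarrow> mdist X (f x) (f x') = mdist Z x x'"
    using iso S unfolding isometric_metric_def by (auto simp: Int_absorb2)
  define h where "h = f \<circ> inv_into S g"
  have h: "h (g x) = f x" if "x \<in> S" for x
    using that inj by (simp add: h_def)
  have "h ` (g ` S) = mspace X"
    using f(1) h by (auto simp: image_image)
  moreover have "mdist X (h u) (h v) = mdist W u v" if "u \<in> g ` S" "v \<in> g ` S" for u v
    using that h f(2) d by auto
  ultimately show ?thesis
    unfolding isometric_metric_def using W by (intro exI[of _ h]) (auto simp: Int_absorb2)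
qed

lemma gh_dist_le:
  fixes X :: "'a metric" and Y :: "'b metric" and Z :: "'c metric"
  assumes r: "0 \<le> r" and sub: "X' \<subseteq> mspace Z" "Y' \<subseteq> mspace Z"
    and isoX: "isometric_metric (submetric Z X') X"
    and isoY: "isometric_metric (submetric Z Y') Y"
    and le: "hausdorff_dist Z X' Y' \<le> ennreal r"
  shows "gh_dist X Y \<le> ennreal r"
proof -
  interpret Z: Metric_space "mspace Z" "mdist Z" by simp
  obtain f where f: "f ` X' = mspace X"
      "\<And>x x'. x \<in> X' \<Longrightarrow> x' \<in> X' \<Longrightarrow> mdist X (f x) (f x') = mdist Z x x'"
    using isoX sub unfolding isometric_metric_def by (auto simp: Int_absorb2)
  obtain k where k: "k ` Y' = mspace Y"
      "\<And>x x'. x \<in> Y' \<Longrightarrow> x' \<in> Y' \<Longrightarrow> mdist Y (k x) (k x') = mdist Z x x'"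
    using isoY sub unfolding isometric_metric_def by (auto simp: Int_absorb2)
  define g :: "'c \<Rightarrow> 'a + 'b" where "g z = (if z \<in> X' then Inl (f z) else Inr (k z))" for z
  let ?U = "X' \<union> Y'"
  have injf: "inj_on f X'"
    by (rule inj_onI) (metis f subsetD sub(1) Z.zero Metric_space.zero Metric_space_mspace_mdist image_eqI)
  have injk: "inj_on k Y'"
    by (rule inj_onI) (metis k subsetD sub(2) Z.zero Metric_space.zero Metric_space_mspace_mdist image_eqI)
  have inj: "inj_on g ?U"
    using injf injk by (auto simp: inj_on_def g_def split: if_splits)
  define p where "p = inv_into ?U g"
  have p: "p (g z) = z" if "z \<in> ?U" for z
    unfolding p_def using inj that by (rule inv_into_f_f)
  have pU: "p w \<in> mspace Z" if "w \<in> g ` ?U" for w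
    using that p sub by auto
  interpret W: Metric_space "g ` ?U" "\<lambda>u v. mdist Z (p u) (p v)"
  proof
    show "mdist Z (p u) (p v) = 0 \<longleftrightarrow> u = v" if "u \<in> g ` ?U" "v \<in> g ` ?U" for u v
      using that pU p Z.zero by (metis imageE)
    show "mdist Z (p u) (p w) \<le> mdist Z (p u) (p v) + mdist Z (p v) (p w)"
      if "u \<in> g ` ?U" "v \<in> g ` ?U" "w \<in> g ` ?U" for u v w
      using that pU Z.triangle by blast
  qed (auto simp: Z.commute)
  define W where "W = metric (g ` ?U, \<lambda>u v. mdist Z (p u) (p v))"
  have mW: "mspace W = g ` ?U" and dW: "mdist W = (\<lambda>u v. mdist Z (p u) (p v))"
    by (simp_all add: W_def)
  have d: "mdist W (g x) (g y) = mdist Z x y" if "x \<in> ?U" "y \<in> ?U" for x y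
    using that by (simp add: dW p)
  have 1: "isometric_metric (submetric W (g ` X')) X"
    using isoX sub(1) inj d by (intro isometric_metric_image[where Z=Z]) (auto simp: mW inj_on_Un)
  have 2: "isometric_metric (submetric W (g ` Y')) Y"
    using isoY sub(2) inj d by (intro isometric_metric_image[where Z=Z]) (auto simp: mW inj_on_Un)
  have "hausdorff_dist W (g ` X') (g ` Y') = hausdorff_dist Z X' Y'"
    unfolding hausdorff_dist_def image_image
    by (intro arg_cong2[where f=max] SUP_cong INF_cong refl) (auto simp: d)
  with 1 2 le r show ?thesis
    unfolding gh_dist_def
    by (intro Inf_lower CollectI exI[of _ r] conjI refl exI[of _ W] exI[of _ "g ` X'"] exI[of _ "g ` Y'"])
       (auto simp: mW)
qed

end

theory Submission
  imports Defs
begin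

text \<open>
  A correspondence of distortion \<open>D < \<infinity>\<close> between \<open>A\<close> and the line yields a map
  \<open>\<phi>\<close> from the line to \<open>A\<close> that changes distances by at most \<open>D\<close>. Such a map cannot jump over
  a gap of length greater than \<open>D\<close>, the line being connected, and it is unbounded in both
  directions. Hence every point of the line is within (about) \<open>D / 2\<close> of \<open>A\<close>: the Hausdorff
  distance from \<open>A\<close> to the line is at most their Gromov--Hausdorff distance. Since \<open>B\<close> is a
  subset of the line, and symmetrically, the Hausdorff distance between \<open>A\<close> and \<open>B\<close> inside the
  line is bounded by the maximum of the two.
\<close>

lemma coarse_isometry_real_not_bounded_below:
  fixes \<phi> :: "real \<Rightarrow> real"
  assumes dis: "\<And>y z. \<bar>\<bar>\<phi> y - \<phi> z\<bar> - \<bar>y - z\<bar>\<bar> \<le> D"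
  shows "\<exists>y. \<phi> y < x"
proof (rule ccontr)
  assume "\<nexists>y. \<phi> y < x"
  then have ge: "x \<le> \<phi> y" for y
    by (meson not_less)
  \<comment> \<open>\<open>\<phi> N\<close> and \<open>\<phi> (- N)\<close> would both lie about \<open>N\<close> to the right of \<open>\<phi> 0\<close>.\<close>
  define N where "N = 2 * \<bar>D\<bar> + \<bar>\<phi> 0 - x\<bar> + 1"
  have "N > 0" by (simp add: N_def)
  \<comment> \<open>The two images would then be at most \<open>2 * D\<close> apart, while the
    distortion bound keeps them at least \<open>2 * N - D\<close> apart.\<close>
  show False
    using dis[of N 0] dis[of "-N" 0] dis[of N "-N"] ge[of N] ge[of "-N"] \<open>N > 0\<close>
    by (simp add: N_def abs_if split: if_splits)
qed

lemma coarse_isometry_real_near: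
  fixes \<phi> :: "real \<Rightarrow> real"
  assumes dis: "\<And>y z. \<bar>\<bar>\<phi> y - \<phi> z\<bar> - \<bar>y - z\<bar>\<bar> \<le> D" and c: "D < 2 * c"
  shows "\<exists>y. \<bar>x - \<phi> y\<bar> < c"
proof (rule ccontr)
  assume "\<nexists>y. \<bar>x - \<phi> y\<bar> < c"
  then have far: "c \<le> \<bar>x - \<phi> y\<bar>" for y
    by (meson not_less)
  obtain y where y: "\<phi> y < x"
    using coarse_isometry_real_not_bounded_below[OF dis] by blast
  obtain z where z: "x < \<phi> z"
    using coarse_isometry_real_not_bounded_below[of "\<lambda>t. - \<phi> t" D "- x"] dis
    by (force simp: abs_minus_commute)
  \<comment> \<open>Values on opposite sides of \<open>x\<close> differ by at least
    \<open>2 * c\<close>, but those at \<open>u\<close> and \<open>v\<close> by at most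
    \<open>\<bar>u - v\<bar> + D\<close>. So the side of \<open>x\<close> is locally constant in the
    argument.\<close>
  have step: "\<phi> u < x \<longleftrightarrow> \<phi> v < x" if "\<bar>u - v\<bar> < 2 * c - D" for u v
    using that dis[of u v] far[of u] far[of v] by (smt (verit))
  have "\<phi> y < x \<longleftrightarrow> \<phi> z < x"
  proof (rule connected_equivalence_relation[of UNIV y z "\<lambda>u v. \<phi> u < x \<longleftrightarrow> \<phi> v < x"])
    fix u :: real
    show "\<exists>T. openin (top_of_set UNIV) T \<and> u \<in> T \<and> (\<forall>v\<in>T. \<phi> u < x \<longleftrightarrow> \<phi> v < x)"
      using step c by (intro exI[of _ "ball u (2 * c - D)"]) (auto simp: dist_real_def)
  qed auto
  with y z show False by simp
qed

lemma hausdorff_dist_less_ennrealD: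
  assumes "hausdorff_dist Z S T < ennreal r" and "t \<in> T"
  shows "\<exists>s\<in>S. mdist Z s t < r"
proof -
  have "(INF s\<in>S. ennreal (mdist Z s t)) \<le> hausdorff_dist Z S T"
    unfolding hausdorff_dist_def using assms(2) by (intro max.coboundedI2 SUP_upper)
  then have "(INF s\<in>S. ennreal (mdist Z s t)) < ennreal r"
    using assms(1) by (rule le_less_trans)
  then show ?thesis
    by (auto simp: INF_less_iff ennreal_less_iff)
qed

text \<open>The slack \<open>\<epsilon>\<close> is there because the infima need not be
  attained.\<close>

lemma hausdorff_dist_le_ennrealI:
  assumes S: "\<And>s \<epsilon>. s \<in> S \<Longrightarrow> 0 < \<epsilon> \<Longrightarrow> \<exists>t\<in>T. mdist Z s t \<le> r + \<epsilon>"
    and T: "\<And>t \<epsilon>. t \<in> T \<Longrightarrow> 0 < \<epsilon> \<Longrightarrow> \<exists>s\<in>S. mdist Z s t \<le> r + \<epsilon>"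
    and r: "0 \<le> r"
  shows "hausdorff_dist Z S T \<le> ennreal r"
proof (rule ennreal_le_epsilon)
  fix \<epsilon> :: real assume \<epsilon>: "0 < \<epsilon>"
  have "(INF t\<in>T. ennreal (mdist Z s t)) \<le> ennreal (r + \<epsilon>)" if "s \<in> S" for s
    using S[OF that \<epsilon>] by (meson INF_lower2 ennreal_leI)
  moreover have "(INF s\<in>S. ennreal (mdist Z s t)) \<le> ennreal (r + \<epsilon>)" if "t \<in> T" for t
    using T[OF that \<epsilon>] by (meson INF_lower2 ennreal_leI)
  ultimately have "hausdorff_dist Z S T \<le> ennreal (r + \<epsilon>)"
    unfolding hausdorff_dist_def by (simp add: SUP_le_iff)
  then show "hausdorff_dist Z S T \<le> ennreal r + ennreal \<epsilon>"
    using r \<epsilon> by (simp add: ennreal_plus)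
qed

lemma gh_dist_real_lessD:
  fixes A :: "real set"
  assumes less: "gh_dist (submetric euclidean_metric A) (euclidean_metric :: real metric) < ennreal r"
  shows "\<exists>a\<in>A. \<bar>x - a\<bar> < r"
proof -
  obtain q and Z :: "(real + real) metric" and X Y where q: "ennreal q < ennreal r" "0 \<le> q"
    and sub: "X \<subseteq> mspace Z" "Y \<subseteq> mspace Z"
    and iso: "isometric_metric (submetric Z X) (submetric euclidean_metric A)"
      "isometric_metric (submetric Z Y) (euclidean_metric :: real metric)"
    and le: "hausdorff_dist Z X Y \<le> ennreal q"
    using less unfolding gh_dist_def Inf_less_iff by blast
  interpret Z: Metric_space "mspace Z" "mdist Z" by simp
  have qr: "q < r"
    using q by (simp add: ennreal_less_iff)
  \<comment> \<open>\<open>q < p\<close> lets the infima yield actual points at distance below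
    \<open>p\<close>; \<open>p < r\<close> gives the strict \<open>2 * p < 2 * r\<close> that
    \<open>coarse_isometry_real_near\<close> asks for.\<close>
  define p where "p = (q + r) / 2"
  have p: "q < p" "p < r"
    using qr by (auto simp: p_def)
  have haus: "hausdorff_dist Z X Y < ennreal p"
    using le p q(2) by (simp add: ennreal_lessI le_less_trans)
  obtain f where f: "f ` X = A"
    "\<And>u v. u \<in> X \<Longrightarrow> v \<in> X \<Longrightarrow> \<bar>f u - f v\<bar> = mdist Z u v"
    using iso(1) sub(1) unfolding isometric_metric_def
    by (auto simp: Int_absorb2 dist_real_def)
  obtain k where k: "k ` Y = (UNIV :: real set)"
    "\<And>u v. u \<in> Y \<Longrightarrow> v \<in> Y \<Longrightarrow> \<bar>k u - k v\<bar> = mdist Z u v"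
    using iso(2) sub(2) unfolding isometric_metric_def
    by (auto simp: Int_absorb2 dist_real_def)
  \<comment> \<open>\<open>w\<close> is a copy of \<open>t\<close> in \<open>Y\<close> and
    \<open>z\<close> a point of \<open>X\<close> near it. Moving between them at both ends of a
    segment costs less than \<open>p\<close> each, so sending \<open>t\<close> to
    \<open>f (z t)\<close> has distortion at most \<open>2 * p\<close>.\<close>
  have "\<exists>w z. w \<in> Y \<and> z \<in> X \<and> k w = t \<and> mdist Z z w < p" for t
    using k(1) hausdorff_dist_less_ennrealD[OF haus] by (metis UNIV_I imageE)
  then obtain w z where wz: "\<And>t. w t \<in> Y" "\<And>t. z t \<in> X" "\<And>t. k (w t) = t"
    "\<And>t. mdist Z (z t) (w t) < p"
    by metis
  have "\<bar>\<bar>f (z s) - f (z t)\<bar> - \<bar>s - t\<bar>\<bar> \<le> 2 * p" for s t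
  proof -
    have m: "z s \<in> mspace Z" "z t \<in> mspace Z" "w s \<in> mspace Z" "w t \<in> mspace Z"
      using wz sub by auto
    have "\<bar>f (z s) - f (z t)\<bar> = mdist Z (z s) (z t)" "\<bar>s - t\<bar> = mdist Z (w s) (w t)"
      using f(2) k(2) wz by metis+
    then show ?thesis
      using Z.triangle[OF m(1,3,2)] Z.triangle[OF m(3,4,2)] Z.triangle[OF m(3,1,4)]
        Z.triangle[OF m(1,2,4)] wz(4)[of s] wz(4)[of t]
        Z.commute[of "z s" "w s"] Z.commute[of "z t" "w t"]
      by (simp add: abs_le_iff)
  qed
  then obtain t where "\<bar>x - f (z t)\<bar> < r"
    using coarse_isometry_real_near[of "\<lambda>t. f (z t)" "2 * p" r x] p by auto
  then show ?thesis
    using f(1) wz(2) by blast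
qed

theorem theorem5:
  fixes A B :: "real set"
  assumes "A \<noteq> {}" and "B \<noteq> {}"
  shows "gh_dist (submetric euclidean_metric A) (submetric euclidean_metric B)
    \<le> max (gh_dist (submetric euclidean_metric A) (euclidean_metric :: real metric))
          (gh_dist (submetric euclidean_metric B) (euclidean_metric :: real metric))"
    (is "_ \<le> ?m")
proof (cases "?m = \<infinity>")
  case False
  then obtain r where r: "0 \<le> r" "?m = ennreal r"
    by (cases ?m) auto
  have less: "?m < ennreal (r + \<epsilon>)" if "0 < \<epsilon>" for \<epsilon>
    unfolding r(2) using r(1) that by (intro ennreal_lessI) auto
  have A: "\<exists>a\<in>A. \<bar>x - a\<bar> < r + \<epsilon>" and B: "\<exists>b\<in>B. \<bar>x - b\<bar> < r + \<epsilon>" if "0 < \<epsilon>" for x \<epsilon>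
    using less[OF that] by (auto intro!: gh_dist_real_lessD)
  \<comment> \<open>The line itself serves as the common space; \<open>gh_dist_le\<close> admits it
    although \<open>gh_dist\<close> ranges over metrics on \<open>real + real\<close>.\<close>
  have "hausdorff_dist euclidean_metric A B \<le> ennreal r"
    using A B r(1)
    by (intro hausdorff_dist_le_ennrealI) (auto simp: dist_real_def abs_minus_commute, (meson less_imp_le)+)
  moreover have refl: "isometric_metric M M" for M :: "real metric"
    unfolding isometric_metric_def by (intro exI[of _ id]) auto
  ultimately show ?thesis
    unfolding r(2) using r(1) by (intro gh_dist_le[of _ A euclidean_metric B]) auto
qed auto

end
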